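(* Suppose that the minimal cost $c_{\min}$ is not attainable for the problem $$(P)\qquad \text{minimize}\ \sum_{s\in S}p_s\sum_{a\in A}\sum_{b\in B}c_{ab}^sq_{ab}^s\quad\text{over } q\in C .$$ For $\lambda>0$ let $Z^\lambda$ denote the set of solutions to $\min_{q\in(\Delta(A\times B))^S}\mathcal{L}(q,\lambda)$. Then the following hold. 1. For every $\lambda\in\,]0,+\infty[$, $Z^\lambda$ is nonempty. 2. $\overline{q}$ is a solution to $(P)$ if and only if there exists $\overline{\lambda}>0$ such that $\overline{q}\in Z^{\overline{\lambda}}$ and $g(\overline{q})=0$. In addition, $\overline{\lambda}>0$ is unique if there exists $s\in S$ such that $c_{ab}^s$ is not constant as $(a,b)\in\mathrm{supp}\,\overline{q}^s$ varies. 3. For every $0<\lambda_1<\lambda_2$ and every $(q_1,q_2)\in Z^{\lambda_1}\times Z^{\lambda_2}$, we have $g(q_1)\ge g(q_2)$.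
   Context: $A,B,S$ are nonempty finite sets with $|A|\ge2$, $(c_{ab}^s)_{a\in A,b\in B,s\in S}$ are real cost values, and $p=(p_s)_{s\in S}$ is a probability distribution on $S$ with $p_s>0$ for all $s$. For a nonempty finite set $I$, $\Delta(I)=\{x\in[0,1]^I:\sum_{i\in I}x_i=1\}$, and for $x\in\mathbb{R}^I$, $\mathrm{supp}(x)=\{i\in I:x_i\neq0\}$. Elements $q\in(\Delta(A\times B))^S$ are written $q=(q^s)_{s\in S}$, $q^s=(q_{ab}^s)_{(a,b)\in A\times B}$. For $s\in S$, $c_{\min}^s=\min_{(a,b)}c_{ab}^s$ and $c_{\max}^s=\max_{(a,b)}c_{ab}^s$; $c_{\min}=\sum_sp_sc_{\min}^s$ and $c_{\max}=\sum_sp_sc_{\max}^s$. Standing assumption: $c_{\min}^s=0$ for all $s\in S$, and $c_{\max}>c_{\min}$. Define $\psi:\mathbb{R}^2\to\,]-\infty,+\infty]$ by $\psi(\xi,\mu)=\xi\ln(\xi/\mu)$ if $\xi>0$ and $\mu>0$; $\psi(0,\mu)=0$ if $\mu\ge0$; and $+\infty$ otherwise. The function $g:(\mathbb{R}^{A\times B})^S\to\,]-\infty,+\infty]$ is $$g(q)=\sum_{s\in S}p_s\sum_{a\in A}\sum_{b\in B}\psi\Big(q_{ab}^s,\sum_{a'\in A}\sum_{s'\in S}p_{s'}q_{a'b}^{s'}\Big)$$ if all components of $q$ are nonnegative, and $g(q)=+\infty$ otherwise. The feasible set is $C=\{q\in(\Delta(A\times B))^S:g(q)\le0\}$. Let $I^s=\{(a,b)\in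 A\times B:c_{ab}^s=c_{\min}^s\}$ and $\Delta_0=\prod_{s\in S}\Delta(I^s)$, viewed as a subset of $(\Delta(A\times B))^S$ via extension by zero. The minimal cost $c_{\min}$ is attainable if $C\cap\Delta_0\neq\varnothing$, equivalently if $\min_{q\in\Delta_0}g(q)\le0$. The Lagrangian is $\mathcal{L}(q,\lambda)=\sum_{s\in S}p_s\sum_{a\in A}\sum_{b\in B}c_{ab}^sq_{ab}^s+\lambda g(q)$ for $\lambda\ge0$. *)

theory Defs
  imports "HOL-Analysis.Analysis"
begin

text \<open>
  The index sets are the universes of finite types \<open>'a\<close> (A), \<open>'b\<close> (B), \<open>'s\<close> (S);
  \<open>q\<^sup>s\<^sub>a\<^sub>b\<close> is \<open>q $ s $ (a, b)\<close> and \<open>c\<^sup>s\<^sub>a\<^sub>b\<close> is \<open>c s (a, b)\<close>.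
\<close>

text \<open>\<open>prob_simplex I\<close> is \<open>\<Delta>(I)\<close>, embedded into the full coordinate space via extension by zero.\<close>

definition prob_simplex :: "'i::finite set \<Rightarrow> (real ^ 'i) set" where
  "prob_simplex I =
     {x. (\<forall>i\<in>I. x $ i \<in> {0..1}) \<and> (\<forall>i. i \<notin> I \<longrightarrow> x $ i = 0) \<and> (\<Sum>i\<in>I. x $ i) = 1}"

definition supp :: "real ^ 'i::finite \<Rightarrow> 'i set" where
  "supp x = {i. x $ i \<noteq> 0}"

definition strategies :: "(real ^ ('a::finite \<times> 'b::finite) ^ 's::finite) set" where
  "strategies = {q. \<forall>s. q $ s \<in> prob_simplex UNIV}"

definition state_min :: "('s \<Rightarrow> 'a::finite \<times> 'b::finite \<Rightarrow> real) \<Rightarrow> 's \<Rightarrow> real" where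
  "state_min c s = Min (range (c s))"

definition state_max :: "('s \<Rightarrow> 'a::finite \<times> 'b::finite \<Rightarrow> real) \<Rightarrow> 's \<Rightarrow> real" where
  "state_max c s = Max (range (c s))"

definition cost_min ::
  "('s::finite \<Rightarrow> real) \<Rightarrow> ('s \<Rightarrow> 'a::finite \<times> 'b::finite \<Rightarrow> real) \<Rightarrow> real" where
  "cost_min p c = (\<Sum>s\<in>UNIV. p s * state_min c s)"

definition cost_max ::
  "('s::finite \<Rightarrow> real) \<Rightarrow> ('s \<Rightarrow> 'a::finite \<times> 'b::finite \<Rightarrow> real) \<Rightarrow> real" where
  "cost_max p c = (\<Sum>s\<in>UNIV. p s * state_max c s)"

definition psi :: "real \<Rightarrow> real \<Rightarrow> ereal" where
  "psi \<xi> \<mu> =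
     (if \<xi> > 0 \<and> \<mu> > 0 then ereal (\<xi> * ln (\<xi> / \<mu>))
      else if \<xi> = 0 \<and> \<mu> \<ge> 0 then 0
      else \<infinity>)"

definition g ::
  "('s::finite \<Rightarrow> real) \<Rightarrow> real ^ ('a::finite \<times> 'b::finite) ^ 's \<Rightarrow> ereal" where
  "g p q =
     (if \<forall>s a b. q $ s $ (a, b) \<ge> 0
      then \<Sum>s\<in>UNIV. ereal (p s) * (\<Sum>a\<in>UNIV. \<Sum>b\<in>UNIV.
             psi (q $ s $ (a, b)) (\<Sum>a'\<in>UNIV. \<Sum>s'\<in>UNIV. p s' * q $ s' $ (a', b)))
      else \<infinity>)"

definition feasible ::
  "('s::finite \<Rightarrow> real) \<Rightarrow> (real ^ ('a::finite \<times> 'b::finite) ^ 's) set" where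
  "feasible p = {q \<in> strategies. g p q \<le> 0}"

definition min_strategies ::
  "('s::finite \<Rightarrow> 'a::finite \<times> 'b::finite \<Rightarrow> real) \<Rightarrow> (real ^ ('a \<times> 'b) ^ 's) set" where
  "min_strategies c = {q. \<forall>s. q $ s \<in> prob_simplex {ab. c s ab = state_min c s}}"

definition min_cost_attainable ::
  "('s::finite \<Rightarrow> real) \<Rightarrow> ('s \<Rightarrow> 'a::finite \<times> 'b::finite \<Rightarrow> real) \<Rightarrow> bool" where
  "min_cost_attainable p c \<longleftrightarrow> feasible p \<inter> min_strategies c \<noteq> {}"

definition expected_cost ::
  "('s::finite \<Rightarrow> real) \<Rightarrow> ('s \<Rightarrow> 'a::finite \<times> 'b::finite \<Rightarrow> real) \<Rightarrow>
     real ^ ('a \<times> 'b) ^ 's \<Rightarrow> real" where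
  "expected_cost p c q =
     (\<Sum>s\<in>UNIV. p s * (\<Sum>a\<in>UNIV. \<Sum>b\<in>UNIV. c s (a, b) * q $ s $ (a, b)))"

definition solves_P ::
  "('s::finite \<Rightarrow> real) \<Rightarrow> ('s \<Rightarrow> 'a::finite \<times> 'b::finite \<Rightarrow> real) \<Rightarrow>
     real ^ ('a \<times> 'b) ^ 's \<Rightarrow> bool" where
  "solves_P p c = is_arg_min (expected_cost p c) (\<lambda>q. q \<in> feasible p)"

text \<open>
  In \<^typ>\<open>ereal\<close> one has \<open>0 * \<infinity> = 0\<close>; this is harmless below since only \<open>lam > 0\<close> occurs.
\<close>

definition lagrangian ::
  "('s::finite \<Rightarrow> real) \<Rightarrow> ('s \<Rightarrow> 'a::finite \<times> 'b::finite \<Rightarrow> real) \<Rightarrow>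
     real ^ ('a \<times> 'b) ^ 's \<Rightarrow> real \<Rightarrow> ereal" where
  "lagrangian p c q lam = ereal (expected_cost p c q) + ereal lam * g p q"

definition Z ::
  "('s::finite \<Rightarrow> real) \<Rightarrow> ('s \<Rightarrow> 'a::finite \<times> 'b::finite \<Rightarrow> real) \<Rightarrow>
     real \<Rightarrow> (real ^ ('a \<times> 'b) ^ 's) set" where
  "Z p c lam = {q. is_arg_min (\<lambda>q. lagrangian p c q lam) (\<lambda>q. q \<in> strategies) q}"

end

theory Submission
  imports Defs "HOL-Real_Asymp.Real_Asymp"
begin

text \<open>
  On the strategies \<open>g\<close> is real valued, convex (joint convexity of \<open>\<xi> ln (\<xi> / \<mu>)\<close>) and continuous
  (it is a difference of sums of \<open>x ln x\<close>), and it is negative at the uniform strategy. Hence the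
  problem is a convex program with one constraint satisfying Slater's condition: a multiplier
  exists, and it is positive because otherwise an unconstrained minimizer of the cost would be
  feasible. For uniqueness, shift a small mass inside some \<open>q\<^sup>s\<close> between two points of its support
  with different costs: \<open>g\<close> is differentiable along this segment, and the first-order condition
  determines the multiplier.
\<close>

declare split_paired_All [simp del] split_paired_Ex [simp del]

section \<open>A Lagrange multiplier for one convex constraint\<close>

text \<open>Strictly feasible points bound the multiplier from above, points with
  \<open>h y > 0\<close> bound it from below, and convexity along a joining segment shows the bounds
  are compatible. The Slater point \<open>z\<close> makes the set of upper bounds nonempty, so its
  infimum can serve as the multiplier.\<close>

lemma convex_multiplier:
  fixes f h :: "'v::real_vector \<Rightarrow> real"
  assumes f: "convex_on X f" and h: "convex_on X h"
    and x: "\<And>y. y \<in> X \<Longrightarrow> h y \<le> 0 \<Longrightarrow> f x \<le> f y"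
    and z: "z \<in> X" "h z < 0"
  obtains l where "l \<ge> 0" "\<And>y. y \<in> X \<Longrightarrow> f x \<le> f y + l * h y"
proof -
  \<comment> \<open>For \<open>h y < 0\<close> the inequality \<open>f x \<le> f y + l * h y\<close>
    says exactly that \<open>l\<close> is at most this quotient.\<close>
  define Q where "Q = (\<lambda>y. (f y - f x) / (- h y)) ` {y \<in> X. h y < 0}"
  have Q0: "r \<ge> 0" if "r \<in> Q" for r
    using that x by (auto simp: Q_def intro!: divide_nonneg_neg)
  have ne: "Q \<noteq> {}" using z by (auto simp: Q_def)
  have bdd: "bdd_below Q" using Q0 by (rule bdd_belowI)
  have "f x \<le> f y + Inf Q * h y" if y: "y \<in> X" for y
  proof (cases "h y" "0::real" rule: linorder_cases)
    case less
    have "Inf Q \<le> (f y - f x) / (- h y)"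
      using y less bdd by (intro cInf_lower) (auto simp: Q_def)
    then show ?thesis using less by (simp add: field_simps)
  next
    case equal
    then show ?thesis using x[OF y] by simp
  next
    case greater
    \<comment> \<open>The left side is the lower bound on the multiplier imposed by the infeasible
      point \<open>y\<close>.\<close>
    have "(f x - f y) / h y \<le> r" if rQ: "r \<in> Q" for r
    proof -
      obtain w where w: "w \<in> X" "h w < 0" and r: "r = (f w - f x) / (- h w)"
        using rQ unfolding Q_def by blast
      \<comment> \<open>The weight at which the interpolated value of \<open>h\<close> is zero, so
        that convexity makes \<open>?v\<close> feasible.\<close>
      define t where "t = - h w / (h y - h w)"
      have t: "0 \<le> t" "t \<le> 1" and t': "1 - t = h y / (h y - h w)"
        using w greater by (auto simp: t_def field_simps)
      let ?v = "(1 - t) *\<^sub>R w + t *\<^sub>R y"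
      have "?v \<in> X" using f t w y by (auto intro: convexD_alt dest: convex_on_imp_convex)
      moreover have "h ?v \<le> (1 - t) * h w + t * h y"
        using convex_onD[OF h t w(1) y] .
      moreover have "(1 - t) * h w + t * h y = 0"
        unfolding t' using w greater by (simp add: t_def field_simps)
      ultimately have "f x \<le> f ?v" using x by simp
      also have "\<dots> \<le> (1 - t) * f w + t * f y"
        using convex_onD[OF f t w(1) y] .
      also have "\<dots> = (h y * f w - h w * f y) / (h y - h w)"
        unfolding t' by (simp add: t_def diff_divide_distrib)
      finally have "f x * (h y - h w) \<le> h y * f w - h w * f y"
        using w greater by (simp add: field_simps)
      then show ?thesis unfolding r using w greater by (simp add: field_simps)
    qed
    then have "(f x - f y) / h y \<le> Inf Q" using ne by (intro cInf_greatest) auto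
    then show ?thesis using greater by (simp add: field_simps)
  qed
  moreover have "Inf Q \<ge> 0" using ne Q0 by (intro cInf_greatest) auto
  ultimately show thesis using that by blast
qed

section \<open>Entropy terms\<close>

text \<open>The value at 0 is 0 because of the factor \<open>x\<close>, which agrees with the
  right-hand limit.\<close>

lemma continuous_on_x_ln_x: "continuous_on {0..} (\<lambda>x::real. x * ln x)"
proof -
  have "((\<lambda>x. x * ln x) \<longlongrightarrow> 0 * ln 0) (at 0 within {0::real..})"
    unfolding at_within_Ici_at_right by simp real_asymp
  moreover have "((\<lambda>x. x * ln x) \<longlongrightarrow> x * ln x) (at x within {0..})" if "x > 0" for x :: real
    using that by (intro tendsto_intros) auto
  ultimately show ?thesis
    unfolding continuous_on_def by (metis atLeast_iff order_le_less)
qed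

text \<open>A vanishing \<open>x\<close> is harmless when \<open>k = 0\<close>, the function being
  constant then. This covers coordinates outside the support that a perturbation leaves
  fixed.\<close>

lemma differentiable_x_ln_x_affine:
  assumes "k \<noteq> 0 \<Longrightarrow> x > 0"
  shows "(\<lambda>t::real. (x + t * k) * ln (x + t * k)) differentiable at 0"
proof (cases "k = 0")
  case False
  then have "((\<lambda>t. (x + t * k) * ln (x + t * k)) has_real_derivative (k * ln x + k)) (at 0)"
    using assms by (auto intro!: derivative_eq_intros)
  then show ?thesis using real_differentiable_def by blast
qed simp

text \<open>This is the log-sum inequality with weights. Since \<open>x * ln (x / y)\<close> is
  positively homogeneous, its tangent plane at \<open>(X, Y)\<close> passes through the origin, so
  \<open>u\<close> and \<open>v\<close> may be arbitrary nonnegative numbers. The implications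
  \<open>ac\<close> exclude \<open>x > 0 = y\<close>, where the HOL quotient is 0 instead of
  infinite.\<close>

lemma rel_entropy_convex:
  fixes x1 x2 y1 y2 u v :: real
  assumes x: "x1 \<ge> 0" "x2 \<ge> 0" and y: "y1 \<ge> 0" "y2 \<ge> 0"
    and ac: "y1 = 0 \<Longrightarrow> x1 = 0" "y2 = 0 \<Longrightarrow> x2 = 0"
    and uv: "u \<ge> 0" "v \<ge> 0"
  defines "X \<equiv> u * x1 + v * x2" and "Y \<equiv> u * y1 + v * y2"
  shows "X * ln (X / Y) \<le> u * (x1 * ln (x1 / y1)) + v * (x2 * ln (x2 / y2))"
proof (cases "X = 0")
  case True
  then have "u * x1 = 0" "v * x2 = 0" unfolding X_def using x uv
    by (simp_all add: add_nonneg_eq_0_iff)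
  then show ?thesis using True by auto
next
  case False
  then have X: "X > 0" unfolding X_def using x uv by (simp add: order_less_le)
  have "Y \<noteq> 0"
  proof
    assume "Y = 0"
    then have "u * y1 = 0" "v * y2 = 0" unfolding Y_def using y uv
      by (simp_all add: add_nonneg_eq_0_iff)
    then show False using False ac unfolding X_def by auto
  qed
  then have Y: "Y > 0" unfolding Y_def using y uv by (simp add: order_less_le)
  define R where "R = X / Y"
  \<comment> \<open>The tangent plane at \<open>(X, Y)\<close>, a consequence of \<open>ln z \<le> z - 1\<close>.\<close>
  have tangent: "x * ln R + x - y * R \<le> x * ln (x / y)"
    if "x \<ge> 0" "y \<ge> 0" "y = 0 \<Longrightarrow> x = 0" for x y
  proof (cases "x = 0")
    case True
    then show ?thesis using X Y that by (simp add: R_def)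
  next
    case False
    then have "y \<noteq> 0" using that by blast
    then have p: "x > 0" "y > 0" using that False by simp_all
    have "ln R - ln (x / y) = ln ((y * X) / (x * Y))"
      using p X Y by (simp add: R_def ln_div ln_mult)
    also have "\<dots> \<le> (y * X) / (x * Y) - 1"
      using p X Y by (intro ln_le_minus_one) auto
    finally have "x * (ln R - ln (x / y)) \<le> x * ((y * X) / (x * Y) - 1)"
      using p by (intro mult_left_mono) auto
    also have "\<dots> = y * R - x" using p Y by (simp add: R_def field_simps)
    finally show ?thesis by (simp add: algebra_simps)
  qed
  \<comment> \<open>The weighted tangent values add up to the value at \<open>(X, Y)\<close>,
    because \<open>Y * R = X\<close> cancels the linear terms.\<close>
  have "X * ln (X / Y) = u * (x1 * ln R + x1 - y1 * R) + v * (x2 * ln R + x2 - y2 * R)"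
  proof -
    have "u * (x1 * ln R + x1 - y1 * R) + v * (x2 * ln R + x2 - y2 * R)
      = X * ln R + X - Y * R"
      by (simp add: X_def Y_def algebra_simps)
    then show ?thesis using Y by (simp add: R_def)
  qed
  also have "\<dots> \<le> u * (x1 * ln (x1 / y1)) + v * (x2 * ln (x2 / y2))"
    using uv tangent x y ac by (intro add_mono mult_left_mono) blast+
  finally show ?thesis .
qed

section \<open>The information constraint on strategies\<close>

definition marginal ::
  "('s::finite \<Rightarrow> real) \<Rightarrow> real ^ ('a::finite \<times> 'b::finite) ^ 's \<Rightarrow> 'b \<Rightarrow> real" where
  "marginal p q b = (\<Sum>a\<in>UNIV. \<Sum>s\<in>UNIV. p s * q $ s $ (a, b))"

text \<open>A real-valued form of \<open>g\<close>. For a strategy and a probability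
  \<open>p\<close> it equals the mutual information of state and \<open>b\<close> minus the
  conditional entropy of \<open>a\<close> given state and \<open>b\<close>.\<close>

definition info ::
  "('s::finite \<Rightarrow> real) \<Rightarrow> real ^ ('a::finite \<times> 'b::finite) ^ 's \<Rightarrow> real" where
  "info p q = (\<Sum>s\<in>UNIV. p s * (\<Sum>a\<in>UNIV. \<Sum>b\<in>UNIV.
      q $ s $ (a, b) * ln (q $ s $ (a, b) / marginal p q b)))"

lemma sum_UNIV_prod: "(\<Sum>a\<in>UNIV. \<Sum>b\<in>UNIV. f (a, b)) = (\<Sum>ab\<in>UNIV. f ab)"
  for f :: "'a::finite \<times> 'b::finite \<Rightarrow> 'c::comm_monoid_add"
  by (simp add: sum.cartesian_product flip: UNIV_Times_UNIV)

lemma strategies_iff: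
  "q \<in> strategies \<longleftrightarrow> (\<forall>s ab. q $ s $ ab \<ge> 0) \<and> (\<forall>s. (\<Sum>ab\<in>UNIV. q $ s $ ab) = 1)"
proof -
  have "x $ i \<le> 1" if "\<forall>i. x $ i \<ge> 0" "(\<Sum>i\<in>UNIV. x $ i) = 1" for x :: "real ^ ('a \<times> 'b)" and i
    unfolding that(2)[symmetric] using that(1) by (intro member_le_sum) auto
  then show ?thesis unfolding strategies_def prob_simplex_def by auto
qed

lemma marginal_ge:
  assumes "\<forall>s. p s > 0" and q: "\<forall>s ab. q $ s $ ab \<ge> 0"
  shows "p s * q $ s $ (a, b) \<le> marginal p q b"
proof -
  have nn: "p s * q $ s $ ab \<ge> 0" for s ab using assms by (simp add: less_imp_le)
  have "p s * q $ s $ (a, b) \<le> (\<Sum>s\<in>UNIV. p s * q $ s $ (a, b))"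
    using nn by (intro member_le_sum[of s UNIV "\<lambda>s. p s * q $ s $ (a, b)"]) auto
  also have "\<dots> \<le> marginal p q b" unfolding marginal_def
    using nn by (intro member_le_sum[of a UNIV "\<lambda>a. \<Sum>s\<in>UNIV. p s * q $ s $ (a, b)"])
      (auto intro: sum_nonneg)
  finally show ?thesis .
qed

lemma marginal_nonneg:
  assumes "\<forall>s. p s > 0" "\<forall>s ab. q $ s $ ab \<ge> 0"
  shows "marginal p q b \<ge> 0"
  unfolding marginal_def using assms by (intro sum_nonneg mult_nonneg_nonneg) (auto simp: less_imp_le)

text \<open>Absolute continuity: a positive mass is never divided by a zero marginal.\<close>

lemma marginal_pos:
  assumes p: "\<forall>s. p s > 0" and q: "\<forall>s ab. q $ s $ ab \<ge> 0" and pos: "q $ s $ (a, b) > 0"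
  shows "marginal p q b > 0"
proof -
  have "p s * q $ s $ (a, b) > 0" using p pos by simp
  with marginal_ge[OF p q, of s a b] show ?thesis by linarith
qed

lemma marginal_add: "marginal p (u *\<^sub>R q + v *\<^sub>R r) b = u * marginal p q b + v * marginal p r b"
  unfolding marginal_def by (simp add: algebra_simps sum.distrib sum_distrib_left)

text \<open>Positive masses have positive marginals, so the infinite branch of \<open>psi\<close> is
  never reached; at mass 0 both expressions vanish.\<close>

lemma g_eq_info:
  assumes p: "\<forall>s. p s > 0" and "q \<in> strategies"
  shows "g p q = ereal (info p q)"
proof -
  have q: "\<forall>s ab. q $ s $ ab \<ge> 0" using assms strategies_iff by blast
  have "psi (q $ s $ (a, b)) (marginal p q b)
      = ereal (q $ s $ (a, b) * ln (q $ s $ (a, b) / marginal p q b))" for s a b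
    using q[rule_format, of s "(a, b)"] marginal_nonneg[OF p q, of b] marginal_pos[OF p q, of s a b]
    by (auto simp: psi_def)
  then show ?thesis using q unfolding g_def info_def marginal_def by simp
qed

text \<open>Splitting the logarithm of the quotient leaves only terms \<open>x * ln x\<close> in
  expressions linear in \<open>q\<close>. Continuity and differentiability are read off from this
  form.\<close>

lemma info_eq_entropy:
  assumes p: "\<forall>s. p s > 0" and q: "\<forall>s ab. q $ s $ ab \<ge> 0"
  shows "info p q = (\<Sum>s\<in>UNIV. p s * (\<Sum>a\<in>UNIV. \<Sum>b\<in>UNIV. q $ s $ (a, b) * ln (q $ s $ (a, b))))
      - (\<Sum>b\<in>UNIV. marginal p q b * ln (marginal p q b))"
proof -
  have t: "q $ s $ (a, b) * ln (q $ s $ (a, b) / marginal p q b)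
      = q $ s $ (a, b) * ln (q $ s $ (a, b)) - q $ s $ (a, b) * ln (marginal p q b)" for s a b
  proof (cases "q $ s $ (a, b) = 0")
    case False
    then have "q $ s $ (a, b) > 0" using q by (simp add: order_less_le)
    moreover from this have "marginal p q b > 0" by (rule marginal_pos[OF p q])
    ultimately show ?thesis by (simp add: ln_div right_diff_distrib)
  qed simp
  \<comment> \<open>The outer factor \<open>marginal\<close> is expanded and the sums are reordered
    to match those of \<open>info\<close>.\<close>
  have "(\<Sum>b\<in>UNIV. marginal p q b * ln (marginal p q b))
      = (\<Sum>b\<in>UNIV. \<Sum>a\<in>UNIV. \<Sum>s\<in>UNIV. p s * (q $ s $ (a, b) * ln (marginal p q b)))"
    unfolding marginal_def by (simp add: sum_distrib_right mult.assoc)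
  also have "\<dots> = (\<Sum>a\<in>UNIV. \<Sum>b\<in>UNIV. \<Sum>s\<in>UNIV. p s * (q $ s $ (a, b) * ln (marginal p q b)))"
    by (rule sum.swap)
  also have "\<dots> = (\<Sum>a\<in>UNIV. \<Sum>s\<in>UNIV. \<Sum>b\<in>UNIV. p s * (q $ s $ (a, b) * ln (marginal p q b)))"
    by (rule sum.cong[OF refl]) (rule sum.swap)
  also have "\<dots> = (\<Sum>s\<in>UNIV. \<Sum>a\<in>UNIV. \<Sum>b\<in>UNIV. p s * (q $ s $ (a, b) * ln (marginal p q b)))"
    by (rule sum.swap)
  also have "\<dots> = (\<Sum>s\<in>UNIV. p s * (\<Sum>a\<in>UNIV. \<Sum>b\<in>UNIV. q $ s $ (a, b) * ln (marginal p q b)))"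
    by (simp add: sum_distrib_left)
  finally show ?thesis
    unfolding info_def t by (simp add: sum_subtractf right_diff_distrib)
qed

section \<open>Convexity, continuity, compactness and a Slater point\<close>

lemma convex_strategies: "convex strategies"
  unfolding convex_def by (auto simp: strategies_iff sum.distrib simp flip: sum_distrib_left)

text \<open>The marginal is linear in \<open>q\<close>, so joint convexity of
  \<open>x * ln (x / y)\<close> applies term by term.\<close>

lemma convex_on_info:
  assumes p: "\<forall>s. p s > 0"
  shows "convex_on strategies (info p)"
proof (intro convex_onI convex_strategies)
  fix t :: real and q r :: "real ^ ('b \<times> 'c) ^ 'a"
  assume t: "0 < t" "t < 1" and "q \<in> strategies" "r \<in> strategies"
  then have q: "\<forall>s ab. q $ s $ ab \<ge> 0" and r: "\<forall>s ab. r $ s $ ab \<ge> 0"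
    using strategies_iff by blast+
  have ac: "x $ s $ (a, b) = 0"
    if "marginal p x b = 0" "\<forall>s ab. x $ s $ ab \<ge> 0" for x :: "real ^ ('b \<times> 'c) ^ 'a" and s a b
    using marginal_pos[OF p that(2), of s a b] that by (metis order_less_le)
  define F where "F x s a b = x $ s $ (a, b) * ln (x $ s $ (a, b) / marginal p x b)"
    for x :: "real ^ ('b \<times> 'c) ^ 'a" and s a b
  have F: "F ((1 - t) *\<^sub>R q + t *\<^sub>R r) s a b \<le> (1 - t) * F q s a b + t * F r s a b" for s a b
    using rel_entropy_convex[of "q $ s $ (a, b)" "r $ s $ (a, b)" "marginal p q b"
        "marginal p r b" "1 - t" t] t q r ac[OF _ q] ac[OF _ r]
      marginal_nonneg[OF p q] marginal_nonneg[OF p r]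
    by (simp add: F_def marginal_add)
  have info: "info p x = (\<Sum>s\<in>UNIV. p s * (\<Sum>a\<in>UNIV. \<Sum>b\<in>UNIV. F x s a b))" for x
    by (simp add: info_def F_def)
  have "info p ((1 - t) *\<^sub>R q + t *\<^sub>R r)
      \<le> (\<Sum>s\<in>UNIV. p s * (\<Sum>a\<in>UNIV. \<Sum>b\<in>UNIV. (1 - t) * F q s a b + t * F r s a b))"
    unfolding info using F p by (intro sum_mono mult_left_mono) (auto simp: less_imp_le)
  also have "\<dots> = (1 - t) * info p q + t * info p r"
    unfolding info by (simp add: sum.distrib sum_distrib_left distrib_left mult.left_commute)
  finally show "info p ((1 - t) *\<^sub>R q + t *\<^sub>R r) \<le> (1 - t) * info p q + t * info p r" .
qed

lemma continuous_on_info: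
  assumes p: "\<forall>s. p s > 0"
  shows "continuous_on strategies (info p)"
proof -
  have cont: "continuous_on strategies (\<lambda>q. F q * ln (F q))"
    if "continuous_on strategies F" "\<And>q. q \<in> strategies \<Longrightarrow> F q \<ge> 0"
    for F :: "real ^ ('b::finite \<times> 'c::finite) ^ 'a \<Rightarrow> real"
    using that by (intro continuous_on_compose2[OF continuous_on_x_ln_x]) auto
  have q: "\<forall>s ab. q $ s $ ab \<ge> 0" if "q \<in> strategies" for q :: "real ^ ('b \<times> 'c) ^ 'a"
    using that strategies_iff by blast
  have "continuous_on strategies (\<lambda>q :: real ^ ('b \<times> 'c) ^ 'a.
      (\<Sum>s\<in>UNIV. p s * (\<Sum>a\<in>UNIV. \<Sum>b\<in>UNIV. q $ s $ (a, b) * ln (q $ s $ (a, b))))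
      - (\<Sum>b\<in>UNIV. marginal p q b * ln (marginal p q b)))"
    by (intro continuous_intros cont q[rule_format] marginal_nonneg[OF p] q)
      (auto simp: marginal_def intro!: continuous_intros)
  then show ?thesis
    by (rule continuous_on_eq) (simp add: info_eq_entropy[OF p q])
qed

lemma compact_strategies: "compact (strategies :: (real ^ ('a::finite \<times> 'b::finite) ^ 's::finite) set)"
proof -
  let ?S = "strategies :: (real ^ ('a \<times> 'b) ^ 's) set"
  have eq: "?S = (\<Inter>s. \<Inter>ab. {q. 0 \<le> q $ s $ ab}) \<inter> (\<Inter>s. {q. (\<Sum>ab\<in>UNIV. q $ s $ ab) = 1})"
    by (auto simp: strategies_iff)
  have "closed ?S" unfolding eq
    by (intro closed_Int closed_INT ballI closed_Collect_le closed_Collect_eq continuous_intros)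
  moreover have "norm q \<le> (\<Sum>s\<in>(UNIV::'s set). 1)" if "q \<in> ?S" for q
  proof -
    have "norm (q $ s) \<le> 1" for s
    proof -
      have "norm (q $ s) \<le> (\<Sum>ab\<in>UNIV. \<bar>q $ s $ ab\<bar>)" by (rule norm_le_l1_cart)
      also have "\<dots> = 1" using that by (simp add: strategies_iff)
      finally show ?thesis .
    qed
    then have "(\<Sum>s\<in>UNIV. norm (q $ s)) \<le> (\<Sum>s\<in>(UNIV::'s set). 1)" by (intro sum_mono)
    moreover have "norm q \<le> (\<Sum>s\<in>UNIV. norm (q $ s))"
      unfolding norm_vec_def[of q] by (rule L2_set_le_sum) auto
    ultimately show ?thesis by linarith
  qed
  then have "bounded ?S" unfolding bounded_iff by blast
  ultimately show ?thesis by (simp add: compact_eq_bounded_closed)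
qed

text \<open>For the uniform strategy every quotient is \<open>1 / CARD('a)\<close>, so the value is
  minus the logarithm of \<open>CARD('a)\<close>.\<close>

lemma info_uniform_neg:
  assumes "CARD('a) \<ge> 2" and p: "\<forall>s. p s > 0" and sum1: "(\<Sum>s\<in>UNIV. p s) = 1"
  obtains q :: "real ^ ('a::finite \<times> 'b::finite) ^ 's::finite"
  where "q \<in> strategies" "info p q < 0"
proof
  let ?n = "real CARD('a)" and ?m = "real CARD('b)"
  let ?q = "\<chi> s ab. 1 / (?n * ?m) :: real ^ ('a \<times> 'b) ^ 's"
  show "?q \<in> strategies" by (simp add: strategies_iff)
  have "marginal p ?q b = (\<Sum>a\<in>(UNIV::'a set). 1 / (?n * ?m))" for b
    unfolding marginal_def using sum1 by (simp flip: sum_divide_distrib)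
  then have "marginal p ?q b = 1 / ?m" for b by simp
  then have "info p ?q = ln (1 / ?n)"
    unfolding info_def using sum1 by (simp flip: sum_distrib_right)
  also have "\<dots> < 0" using assms(1) by (intro ln_less_zero) auto
  finally show "info p ?q < 0" .
qed

section \<open>The Lagrangian\<close>

lemma linear_expected_cost: "linear (expected_cost p c)"
  by (rule linearI)
    (simp_all add: expected_cost_def sum.distrib sum_distrib_left algebra_simps)

lemma lagrangian_eq:
  assumes "\<forall>s. p s > 0" "q \<in> strategies"
  shows "lagrangian p c q l = ereal (expected_cost p c q + l * info p q)"
  using assms by (simp add: lagrangian_def g_eq_info)

lemma in_Z_iff:
  assumes p: "\<forall>s. p s > 0"
  shows "q \<in> Z p c l \<longleftrightarrow> q \<in> strategies \<and> (\<forall>r\<in>strategies.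
    expected_cost p c q + l * info p q \<le> expected_cost p c r + l * info p r)"
  by (auto simp: Z_def is_arg_min_linorder lagrangian_eq[OF p])

text \<open>A continuous function attains its minimum on a nonempty compact set.\<close>

lemma Z_nonempty:
  fixes p :: "'s::finite \<Rightarrow> real" and c :: "'s \<Rightarrow> 'a::finite \<times> 'b::finite \<Rightarrow> real"
  assumes p: "\<forall>s. p s > 0"
  shows "Z p c l \<noteq> {}"
proof -
  let ?S = "strategies :: (real ^ ('a \<times> 'b) ^ 's) set"
  have "(\<chi> s ab. 1 / real CARD('a \<times> 'b)) \<in> ?S" by (simp add: strategies_iff)
  then have "?S \<noteq> {}" by blast
  moreover have "continuous_on ?S (\<lambda>q. expected_cost p c q + l * info p q)"
    by (intro continuous_intros continuous_on_info p linear_continuous_on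
        linear_conv_bounded_linear[THEN iffD1] linear_expected_cost)
  ultimately show ?thesis
    using continuous_attains_inf[OF compact_strategies] in_Z_iff[OF p] by blast
qed

text \<open>Each minimizer is tested against the other; adding the two inequalities cancels the
  costs.\<close>

lemma info_antimono_Z:
  assumes p: "\<forall>s. p s > 0" and l: "l1 < l2" and q: "q1 \<in> Z p c l1" "q2 \<in> Z p c l2"
  shows "info p q2 \<le> info p q1"
proof -
  have "(l2 - l1) * info p q2 \<le> (l2 - l1) * info p q1"
    using q in_Z_iff[OF p, of q1 c l1] in_Z_iff[OF p, of q2 c l2]
    by (force simp: algebra_simps)
  then show ?thesis using l by simp
qed

lemma solves_P_iff:
  assumes p: "\<forall>s. p s > 0"
  shows "solves_P p c q \<longleftrightarrow> q \<in> strategies \<and> info p q \<le> 0 \<and>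
    (\<forall>r\<in>strategies. info p r \<le> 0 \<longrightarrow> expected_cost p c q \<le> expected_cost p c r)"
  by (auto simp: solves_P_def is_arg_min_linorder feasible_def g_eq_info[OF p])

text \<open>The penalty \<open>l * info\<close> vanishes at \<open>q\<close> and is nonpositive at
  every feasible point.\<close>

lemma solves_P_if_Z:
  assumes p: "\<forall>s. p s > 0" and l: "l > 0" and q: "q \<in> Z p c l" "info p q = 0"
  shows "solves_P p c q"
  unfolding solves_P_iff[OF p]
proof (intro conjI ballI impI)
  fix r :: "real ^ ('b \<times> 'c) ^ 'a"
  assume "r \<in> strategies" "info p r \<le> 0"
  then have "expected_cost p c q \<le> expected_cost p c r + l * info p r" "l * info p r \<le> 0"
    using q l in_Z_iff[OF p, of q c l] by (auto simp: mult_nonneg_nonpos)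
  then show "expected_cost p c q \<le> expected_cost p c r" by linarith
qed (use q in_Z_iff[OF p] in auto)

section \<open>Strategies of minimal cost\<close>

lemma min_strategies_subset: "min_strategies c \<subseteq> strategies"
proof
  fix q assume q: "q \<in> min_strategies c"
  have "q $ s $ ab \<ge> 0" for s ab
    using q by (cases "c s ab = state_min c s") (auto simp: min_strategies_def prob_simplex_def)
  moreover have "(\<Sum>ab\<in>UNIV. q $ s $ ab) = (\<Sum>ab\<in>{ab. c s ab = state_min c s}. q $ s $ ab)" for s
    using q by (intro sum.mono_neutral_right) (auto simp: min_strategies_def prob_simplex_def)
  ultimately show "q \<in> strategies"
    using q by (auto simp: strategies_iff min_strategies_def prob_simplex_def)
qed

text \<open>All costs are nonnegative, so each summand must vanish; as \<open>p s > 0\<close>, mass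
  can sit only where the cost is 0, the state minimum.\<close>

lemma expected_cost_0_imp_min_strategies:
  assumes p: "\<forall>s. p s > 0" and c: "\<And>s. state_min c s = 0"
    and q: "q \<in> strategies" and le: "expected_cost p c q \<le> 0"
  shows "q \<in> min_strategies c"
proof -
  have c0: "c s ab \<ge> 0" for s ab
    using c[of s] Min_le[of "range (c s)" "c s ab"] by (simp add: state_min_def)
  have q0: "\<forall>s ab. q $ s $ ab \<ge> 0" and q1: "\<And>s. (\<Sum>ab\<in>UNIV. q $ s $ ab) = 1"
    using q by (auto simp: strategies_iff)
  have E: "expected_cost p c q = (\<Sum>s\<in>UNIV. p s * (\<Sum>ab\<in>UNIV. c s ab * q $ s $ ab))"
    unfolding expected_cost_def by (subst sum_UNIV_prod) rule
  have nn: "p s * (\<Sum>ab\<in>UNIV. c s ab * q $ s $ ab) \<ge> 0" for s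
    using p[rule_format, of s] c0 q0 by (intro mult_nonneg_nonneg sum_nonneg) auto
  have "expected_cost p c q = 0" unfolding E using le nn by (intro antisym sum_nonneg) (auto simp: E)
  then have E0: "p s * (\<Sum>ab\<in>UNIV. c s ab * q $ s $ ab) = 0" for s
    unfolding E using nn by (subst (asm) sum_nonneg_eq_0_iff) auto
  have "(\<Sum>ab\<in>UNIV. c s ab * q $ s $ ab) = 0" for s
    using E0[of s] p[rule_format, of s] by (auto simp only: mult_eq_0_iff less_irrefl)
  then have "c s ab * q $ s $ ab = 0" for s ab
    using c0 q0 by (subst (asm) sum_nonneg_eq_0_iff) auto
  then have z: "q $ s $ ab = 0" if "c s ab \<noteq> 0" for s ab using that by fastforce
  have "(\<Sum>ab\<in>UNIV. q $ s $ ab) = (\<Sum>ab\<in>{ab. c s ab = 0}. q $ s $ ab)" for s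
    using z by (intro sum.mono_neutral_right) auto
  then show ?thesis
    using q q1 z by (auto simp: min_strategies_def strategies_def prob_simplex_def c)
qed

lemma expected_cost_min_strategies:
  assumes "\<And>s. state_min c s = 0" "q \<in> min_strategies c"
  shows "expected_cost p c q = 0"
proof -
  have z: "c s ab * q $ s $ ab = 0" for s ab
    using assms by (cases "c s ab = 0") (auto simp: min_strategies_def prob_simplex_def)
  then show ?thesis by (simp only: expected_cost_def z mult_zero_right sum.neutral_const)
qed

text \<open>In each state, a point mass at a cost minimizer.\<close>

lemma min_strategies_nonempty: "min_strategies c \<noteq> {}"
proof -
  have "\<exists>ab. c s ab = state_min c s" for s
    using Min_in[of "range (c s)"] by (fastforce simp: state_min_def)
  then obtain m where m: "\<And>s. c s (m s) = state_min c s" by metis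
  have "(\<chi> s. axis (m s) 1) \<in> min_strategies c"
    using m by (auto simp: min_strategies_def prob_simplex_def axis_def sum.delta)
  then show ?thesis by blast
qed

lemma solves_P_multiplier:
  fixes p :: "'s::finite \<Rightarrow> real" and c :: "'s \<Rightarrow> 'a::finite \<times> 'b::finite \<Rightarrow> real"
  assumes card: "CARD('a) \<ge> 2" and p: "\<forall>s. p s > 0" and p1: "(\<Sum>s\<in>UNIV. p s) = 1"
    and c: "\<And>s. state_min c s = 0" and na: "\<not> min_cost_attainable p c" and q: "solves_P p c q"
  obtains l where "l > 0" "q \<in> Z p c l" "info p q = 0"
proof -
  obtain z :: "real ^ ('a \<times> 'b) ^ 's" where z: "z \<in> strategies" "info p z < 0"
    using info_uniform_neg[OF card p p1] .
  have qs: "q \<in> strategies" "info p q \<le> 0" using q by (auto simp: solves_P_iff[OF p])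
  have "convex_on strategies (expected_cost p c)"
    using linear_expected_cost[of p c] convex_strategies
    by (simp add: convex_on_def linear_add linear_scale)
  then obtain l where l: "l \<ge> 0"
    and min: "\<And>r. r \<in> strategies \<Longrightarrow> expected_cost p c q \<le> expected_cost p c r + l * info p r"
    using convex_multiplier[OF _ convex_on_info[OF p] _ z, of "expected_cost p c" q] q
    by (auto simp: solves_P_iff[OF p])
  \<comment> \<open>With a zero multiplier \<open>q\<close> would minimize the cost over all
    strategies. Its cost would be 0, and being feasible it would attain the minimal cost.\<close>
  have "l \<noteq> 0"
  proof
    assume "l = 0"
    then have "\<And>r. r \<in> strategies \<Longrightarrow> expected_cost p c q \<le> expected_cost p c r"
      using min by simp
    moreover obtain r where "r \<in> min_strategies c" using min_strategies_nonempty by blast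
    ultimately have "expected_cost p c q \<le> 0"
      using min_strategies_subset expected_cost_min_strategies[OF c] by (metis subsetD)
    then have "q \<in> min_strategies c" using expected_cost_0_imp_min_strategies[OF p c qs(1)] by blast
    then show False
      using na qs by (auto simp: min_cost_attainable_def feasible_def g_eq_info[OF p])
  qed
  then have pos: "l > 0" using l by simp
  \<comment> \<open>Complementary slackness, from testing the multiplier inequality at
    \<open>q\<close> itself.\<close>
  have "l * info p q \<ge> 0" using min[OF qs(1)] by simp
  then have "info p q = 0" using pos qs(2) by (simp add: zero_le_mult_iff)
  moreover from this have "q \<in> Z p c l" using qs min by (simp add: in_Z_iff[OF p])
  ultimately show thesis using that pos by blast
qed

section \<open>Uniqueness of the multiplier\<close>

text \<open>Only coordinates that are positive at \<open>q\<close> move, so every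
  \<open>x * ln x\<close> term is either constant or differentiable at 0.\<close>

lemma info_differentiable_direction:
  fixes q d :: "real ^ ('a::finite \<times> 'b::finite) ^ 's::finite"
  assumes p: "\<forall>s. p s > 0" and q: "\<forall>s ab. q $ s $ ab \<ge> 0"
    and d: "\<And>s ab. d $ s $ ab \<noteq> 0 \<Longrightarrow> q $ s $ ab > 0"
    and e: "e > 0" and nn: "\<And>t s ab. \<bar>t\<bar> < e \<Longrightarrow> (q + t *\<^sub>R d) $ s $ ab \<ge> 0"
  shows "(\<lambda>t. info p (q + t *\<^sub>R d)) differentiable at 0"
proof -
  have marg: "marginal p (q + t *\<^sub>R d) b = marginal p q b + t * marginal p d b" for t b
    using marginal_add[of p 1 q t d b] by simp
  \<comment> \<open>A marginal can change only if some coordinate over \<open>b\<close> moves; that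
    coordinate is positive at \<open>q\<close>, hence so is the marginal.\<close>
  have mpos: "marginal p q b > 0" if "marginal p d b \<noteq> 0" for b
  proof -
    have "\<exists>a s. d $ s $ (a, b) \<noteq> 0"
      using that by (rule contrapos_np) (simp add: marginal_def)
    then show ?thesis using marginal_pos[OF p q] d by blast
  qed
  let ?f = "\<lambda>t. (\<Sum>s\<in>UNIV. p s * (\<Sum>a\<in>UNIV. \<Sum>b\<in>UNIV.
        (q $ s $ (a, b) + t * d $ s $ (a, b)) * ln (q $ s $ (a, b) + t * d $ s $ (a, b))))
      - (\<Sum>b\<in>UNIV. (marginal p q b + t * marginal p d b) * ln (marginal p q b + t * marginal p d b))"
  have entropy: "(\<lambda>t. (q $ s $ ab + t * d $ s $ ab) * ln (q $ s $ ab + t * d $ s $ ab)) differentiable at 0"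
    for s ab by (rule differentiable_x_ln_x_affine) (rule d)
  have mentropy: "(\<lambda>t. (marginal p q b + t * marginal p d b) * ln (marginal p q b + t * marginal p d b))
      differentiable at 0" for b by (rule differentiable_x_ln_x_affine) (rule mpos)
  have "?f differentiable at 0"
    by (intro differentiable_diff differentiable_sum differentiable_mult[OF differentiable_const]
        entropy mentropy ballI finite)
  then obtain D where D: "(?f has_derivative D) (at 0)" unfolding differentiable_def by blast
  \<comment> \<open>The entropy form requires nonnegative masses, hence the restriction to a ball,
    which suffices for a derivative at 0.\<close>
  have eq: "?f t = info p (q + t *\<^sub>R d)" if "t \<in> ball 0 e" for t
    using that nn[of t] by (subst info_eq_entropy[OF p]) (auto simp: marg)
  have "((\<lambda>t. info p (q + t *\<^sub>R d)) has_derivative D) (at 0)"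
    by (rule has_derivative_transform_within_open[OF D open_ball[of 0 e] _ eq]) (use e in simp)
  then show ?thesis unfolding differentiable_def by blast
qed

text \<open>Along a suitable segment the optimality condition is \<open>k + l * D = 0\<close>, where
  the cost slope \<open>k\<close> is nonzero and \<open>k\<close>, \<open>D\<close> do not depend on
  \<open>l\<close>.\<close>

lemma multiplier_unique:
  fixes c :: "'s::finite \<Rightarrow> 'a::finite \<times> 'b::finite \<Rightarrow> real"
  assumes p: "\<forall>s. p s > 0" and Z: "q \<in> Z p c l1" "q \<in> Z p c l2"
    and nc: "\<not> c s constant_on supp (q $ s)"
  shows "l1 = l2"
proof -
  have qs: "q \<in> strategies" using Z in_Z_iff[OF p] by blast
  then have q: "\<forall>s ab. q $ s $ ab \<ge> 0" by (simp add: strategies_iff)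
  obtain i j where ij: "q $ s $ i \<noteq> 0" "q $ s $ j \<noteq> 0" and cij: "c s i \<noteq> c s j"
    using nc unfolding constant_on_def supp_def by blast
  then have ne: "i \<noteq> j" and pos: "q $ s $ i > 0" "q $ s $ j > 0" using q by (auto simp: order_less_le)
  \<comment> \<open>Moves mass from \<open>j\<close> to \<open>i\<close> within state
    \<open>s\<close>. Both masses are positive, so small steps of either sign stay among the
    strategies.\<close>
  define d :: "real ^ ('a \<times> 'b) ^ 's" where "d = axis s (axis i 1 - axis j 1)"
  define e where "e = min (q $ s $ i) (q $ s $ j)"
  have e: "e > 0" using pos by (simp add: e_def)
  have dc: "d $ s' $ ab = (if s' = s then (if ab = i then 1 else if ab = j then -1 else 0) else 0)" for s' ab
    using ne by (auto simp: d_def axis_def)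
  have nn: "(q + t *\<^sub>R d) $ s' $ ab \<ge> 0" if "\<bar>t\<bar> < e" for t s' ab
    using that q[rule_format, of s' ab] by (auto simp: dc e_def)
  have d0: "(\<Sum>ab\<in>UNIV. d $ s' $ ab) = 0" for s'
    by (cases "s' = s") (simp_all add: d_def axis_def sum_subtractf)
  have str: "q + t *\<^sub>R d \<in> strategies" if "\<bar>t\<bar> < e" for t
    using nn[OF that] qs d0 by (auto simp: strategies_iff sum.distrib simp flip: sum_distrib_left)
  have dpos: "q $ s' $ ab > 0" if "d $ s' $ ab \<noteq> 0" for s' ab
    using that pos by (auto simp: dc split: if_splits)
  obtain D where D: "((\<lambda>t. info p (q + t *\<^sub>R d)) has_real_derivative D) (at 0)"
    using info_differentiable_direction[OF p q dpos e nn] unfolding real_differentiable_def by blast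
  define k where "k = expected_cost p c d"
  have cost: "expected_cost p c (q + t *\<^sub>R d) = expected_cost p c q + t * k" for t
    using linear_expected_cost[of p c] by (simp add: linear_add linear_scale k_def)
  \<comment> \<open>The parameter 0 is interior to the admissible interval, so the derivative of the
    Lagrangian vanishes there, not merely the one-sided inequality.\<close>
  have first_order: "k + l * D = 0" if "q \<in> Z p c l" for l
  proof (rule DERIV_local_min[OF _ e])
    show "((\<lambda>t. expected_cost p c (q + t *\<^sub>R d) + l * info p (q + t *\<^sub>R d))
        has_real_derivative (k + l * D)) (at 0)"
      unfolding cost by (auto intro!: derivative_eq_intros D)
    show "\<forall>t. \<bar>0 - t\<bar> < e \<longrightarrow> expected_cost p c (q + 0 *\<^sub>R d) + l * info p (q + 0 *\<^sub>R d)
        \<le> expected_cost p c (q + t *\<^sub>R d) + l * info p (q + t *\<^sub>R d)"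
      using that str in_Z_iff[OF p, of q c l] by simp
  qed
  have "k = (\<Sum>s'\<in>UNIV. p s' * (\<Sum>ab\<in>UNIV. c s' ab * d $ s' $ ab))"
    unfolding k_def expected_cost_def by (subst sum_UNIV_prod) rule
  also have "\<dots> = (\<Sum>s'\<in>UNIV. if s' = s then p s * (\<Sum>ab\<in>UNIV. c s ab * d $ s $ ab) else 0)"
    by (intro sum.cong) (auto simp: dc)
  also have "\<dots> = p s * (\<Sum>ab\<in>UNIV. c s ab * d $ s $ ab)" by simp
  also have "(\<Sum>ab\<in>UNIV. c s ab * d $ s $ ab) = (\<Sum>ab\<in>{i, j}. c s ab * d $ s $ ab)"
    by (intro sum.mono_neutral_right) (auto simp: dc)
  also have "\<dots> = c s i - c s j" using ne by (simp add: dc)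
  finally have "k \<noteq> 0" using p[rule_format, of s] cij by simp
  \<comment> \<open>Either the multipliers agree or \<open>D = 0\<close>; the latter would force
    \<open>k = 0\<close>.\<close>
  moreover have "(l1 - l2) * D = 0" 
    using first_order[OF Z(1)] first_order[OF Z(2)] unfolding left_diff_distrib by linarith
  ultimately show ?thesis using first_order[OF Z(1)] by auto
qed

theorem proposition5p1:
  fixes p :: "'s::finite \<Rightarrow> real"
    and c :: "'s \<Rightarrow> 'a::finite \<times> 'b::finite \<Rightarrow> real"
  assumes "CARD('a) \<ge> 2"
    and "\<And>s. p s > 0"
    and "(\<Sum>s\<in>UNIV. p s) = 1"
    and "\<And>s. state_min c s = 0"
    and "cost_max p c > cost_min p c"
    and "\<not> min_cost_attainable p c"
  shows "(\<forall>lam>0. Z p c lam \<noteq> {}) \<and>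
    (\<forall>q. solves_P p c q \<longleftrightarrow> (\<exists>lam>0. q \<in> Z p c lam \<and> g p q = 0)) \<and>
    (\<forall>q. solves_P p c q \<longrightarrow> (\<exists>s. \<not> c s constant_on supp (q $ s)) \<longrightarrow>
       (\<exists>!lam. lam > 0 \<and> q \<in> Z p c lam \<and> g p q = 0)) \<and>
    (\<forall>lam1 lam2. 0 < lam1 \<longrightarrow> lam1 < lam2 \<longrightarrow>
       (\<forall>q1\<in>Z p c lam1. \<forall>q2\<in>Z p c lam2. g p q1 \<ge> g p q2))"
proof -
  have p: "\<forall>s. p s > 0" using assms(2) by blast
  \<comment> \<open>Members of \<open>Z\<close> are strategies, so all statements about
    \<open>g\<close> reduce to the real-valued \<open>info\<close>.\<close>
  have gZ: "g p q = ereal (info p q)" if "q \<in> Z p c l" for q l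
    using that in_Z_iff[OF p] g_eq_info[OF p] by blast
  have ex: "\<exists>lam>0. q \<in> Z p c lam \<and> g p q = 0" if "solves_P p c q" for q
    using solves_P_multiplier[OF assms(1) p assms(3,4,6) that] gZ by (metis zero_ereal_def)
  have "solves_P p c q" if "lam > 0" "q \<in> Z p c lam" "g p q = 0" for q lam
    using solves_P_if_Z[OF p that(1,2)] gZ[OF that(2)] that(3) by (simp add: zero_ereal_def)
  moreover have "\<exists>!lam. lam > 0 \<and> q \<in> Z p c lam \<and> g p q = 0"
    if "solves_P p c q" "\<not> c s constant_on supp (q $ s)" for q s
    using ex[OF that(1)] multiplier_unique[OF p] that(2) by blast
  moreover have "g p q1 \<ge> g p q2"
    if "lam1 < lam2" "q1 \<in> Z p c lam1" "q2 \<in> Z p c lam2" for lam1 lam2 q1 q2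
    using info_antimono_Z[OF p that] gZ that by simp
  ultimately show ?thesis using ex Z_nonempty[OF p] by blast
qed

end
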